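(* Let $N(\ell) = \min\{n \geq 0 : L(n) = \ell\}$ be the minimum number of stones in a winning Tchoukaillon board of length $\ell$. Then $N(\ell) = O(\ell^2)$; more precisely, \[ \frac{\ell^2}{4} + O(\ell) \leq N(\ell) \leq \frac{\ell^2}{2} + O(\ell) \quad (\ell \to \infty), \] i.e. there is a constant $C$ such that $\frac{\ell^2}{4} - C\ell \leq N(\ell) \leq \frac{\ell^2}{2} + C\ell$ for all $\ell \geq 1$.
   Context: Tchoukaillon boards. For each $n \geq 0$ define a sequence $b(n) = (b_1(n), b_2(n), \ldots)$ of nonnegative integers recursively: $b(0)$ is the all-zero sequence; given $b(n)$, let $p(n) = \min\{j \geq 1 : b_j(n) = 0\}$ and set $b_i(n+1) = b_i(n)$ if $i > p(n)$, $b_i(n+1) = i$ if $i = p(n)$, and $b_i(n+1) = b_i(n) - 1$ if $i < p(n)$. $b(n)$ is the unique winning Tchoukaillon board with $n$ stones. Its length is $L(n) = \min\{i \geq 0 : b_j(n) = 0 \text{ for all } j > i\}$. *)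

theory Defs
  imports Complex_Main "HOL-Library.Landau_Symbols"
begin

text \<open>
  A board is a function from nat to nat. Pits are numbered from 1; the value at index 0 carries
  no information (it is always 0 on the boards below).
\<close>

definition first_empty_pit :: "(nat \<Rightarrow> nat) \<Rightarrow> nat" where
  "first_empty_pit b = (LEAST j. 1 \<le> j \<and> b j = 0)"

text \<open>
  Pits strictly below the first empty one are nonempty, so the truncated subtraction in the
  last case is an ordinary one for every pit number from 1 on.
\<close>

primrec board :: "nat \<Rightarrow> nat \<Rightarrow> nat" where
  "board 0 = (\<lambda>i. 0)"
| "board (Suc n) = (\<lambda>i.
     if i > first_empty_pit (board n) then board n i
     else if i = first_empty_pit (board n) then i
     else board n i - 1)"

definition board_length :: "nat \<Rightarrow> nat" where
  "board_length n = (LEAST i. \<forall>j>i. board n j = 0)"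

definition min_stones :: "nat \<Rightarrow> nat" where
  "min_stones l = (LEAST n. board_length n = l)"

text \<open>The minima above are taken over nonempty sets, and \<^term>\<open>board n\<close> has \<open>n\<close> stones.\<close>

lemma board_finite_support: "\<exists>m. \<forall>j>m. board n j = 0"
proof (induction n)
  case (Suc n)
  then obtain m where "\<forall>j>m. board n j = 0" by blast
  then have "\<forall>j>max m (first_empty_pit (board n)). board (Suc n) j = 0" by simp
  then show ?case by blast
qed simp

lemma board_beyond_length: "j > board_length n \<Longrightarrow> board n j = 0"
  using LeastI_ex[OF board_finite_support[of n]] unfolding board_length_def by blast

lemma board_length_le: "(\<And>j. j > m \<Longrightarrow> board n j = 0) \<Longrightarrow> board_length n \<le> m"
  unfolding board_length_def by (rule Least_le) blast

lemma first_empty_pit_board: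
  "1 \<le> first_empty_pit (board n)" "board n (first_empty_pit (board n)) = 0"
proof -
  have "\<exists>j. 1 \<le> j \<and> board n j = 0"
    using board_beyond_length[of n "Suc (board_length n)"] by (intro exI[of _ "Suc (board_length n)"]) simp
  from LeastI_ex[OF this]
  show "1 \<le> first_empty_pit (board n)" "board n (first_empty_pit (board n)) = 0"
    unfolding first_empty_pit_def by auto
qed

lemma board_below_first_empty_pit:
  "1 \<le> i \<Longrightarrow> i < first_empty_pit (board n) \<Longrightarrow> 1 \<le> board n i"
  using not_less_Least[of i "\<lambda>j. 1 \<le> j \<and> board n j = 0"] unfolding first_empty_pit_def by auto

lemma first_empty_pit_le_length: "first_empty_pit (board n) \<le> Suc (board_length n)"
  unfolding first_empty_pit_def by (rule Least_le) (simp add: board_beyond_length)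

lemma board_length_Suc: "board_length (Suc n) \<le> Suc (board_length n)"
  using first_empty_pit_le_length[of n] by (intro board_length_le) (simp add: board_beyond_length)

lemma board_le: "board n i \<le> i"
proof (induction n arbitrary: i)
  case (Suc n)
  show ?case using Suc[of i] by (auto intro: le_trans[OF diff_le_self])
qed simp

lemma board_stones: "(\<forall>k\<le>n. board_length k \<le> M) \<Longrightarrow> (\<Sum>i=1..M. board n i) = n"
proof (induction n)
  case (Suc n)
  define p where "p = first_empty_pit (board n)"
  have IH: "(\<Sum>i=1..M. board n i) = n" using Suc by simp
  have p1: "1 \<le> p" "board n p = 0" using first_empty_pit_board[of n] by (simp_all add: p_def)
  have pM: "p \<le> M"
  proof (rule ccontr)
    assume "\<not> p \<le> M"
    then have "p > board_length (Suc n)" using Suc.prems by (meson le_refl le_trans not_le)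
    then have "board (Suc n) p = 0" by (rule board_beyond_length)
    then show False using p1 by (simp add: p_def)
  qed
  have split: "{1..M} = {1..<p} \<union> {p} \<union> {p<..M}" using p1 pM by auto
  have dec: "(\<Sum>i=1..M. f i) = (\<Sum>i=1..<p. f i) + f p + (\<Sum>i\<in>{p<..M}. f i)" for f :: "nat \<Rightarrow> nat"
    unfolding split by (subst sum.union_disjoint; auto)+
  have "board n i = board (Suc n) i + 1" if "i \<in> {1..<p}" for i
    using board_below_first_empty_pit[of i n] that by (simp add: p_def)
  then have "(\<Sum>i=1..<p. board n i) = (\<Sum>i=1..<p. board (Suc n) i + 1)"
    by (intro sum.cong refl)
  then have low: "(\<Sum>i=1..<p. board n i) = (\<Sum>i=1..<p. board (Suc n) i) + (p - 1)"
    by (simp only: sum.distrib) simp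
  have high: "(\<Sum>i\<in>{p<..M}. board (Suc n) i) = (\<Sum>i\<in>{p<..M}. board n i)"
    by (intro sum.cong) (auto simp: p_def)
  have mid: "board (Suc n) p = p" by (simp add: p_def)
  show ?case
    using dec[of "board n"] dec[of "board (Suc n)"] low high mid IH p1 by linarith
qed simp

lemma board_length_surj: "\<exists>n. board_length n = l"
proof -
  have "\<exists>n. l \<le> board_length n"
  proof (rule ccontr)
    assume "\<not> ?thesis"
    then have "\<forall>k. board_length k \<le> l" by (meson linear)
    then have "(\<Sum>i=1..l. board (Suc (\<Sum>i=1..l. i)) i) = Suc (\<Sum>i=1..l. i)"
      by (intro board_stones) simp
    moreover have "(\<Sum>i=1..l. board (Suc (\<Sum>i=1..l. i)) i) \<le> (\<Sum>i=1..l. i)"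
      by (intro sum_mono board_le)
    ultimately show False by linarith
  qed
  then obtain n where "l \<le> board_length n" by blast
  then show ?thesis
  proof (induction n)
    case 0
    have "board_length 0 \<le> 0" by (rule board_length_le) simp
    then show ?case using 0 by (intro exI[of _ 0]) simp
  next
    case (Suc n)
    show ?case
    proof (cases "l \<le> board_length n")
      case False
      then have "board_length (Suc n) = l" using Suc.prems board_length_Suc[of n] by linarith
      then show ?thesis by blast
    qed (use Suc.IH in blast)
  qed
qed

end

theory Submission
  imports Defs
begin

text \<open>
  Let \<open>S i n\<close> be the number of the first \<open>n\<close> steps whose first empty pit is at least \<open>i\<close>. Counting
  the stones that enter and leave pit \<open>i\<close> gives \<open>b\<^sub>i(n) = i S i n - (i + 1) S (i + 1) n\<close>. So
  \<open>i S i n\<close> is decreasing in \<open>i\<close>, with value \<open>n\<close> at \<open>i = 1\<close>, and \<open>S i n\<close> drops strictly as long as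
  it is positive. If the board has length \<open>l\<close>, then \<open>S l n \<ge> 1\<close>, hence \<open>S i n \<ge> l + 1 - i\<close> and
  \<open>n \<ge> i (l + 1 - i)\<close>; take \<open>i\<close> about \<open>l / 2\<close>. For the upper bound, a shortest sequence of boards
  that reaches length \<open>l\<close> uses only the pits \<open>1, \<dots>, l\<close>, and pit \<open>i\<close> never holds more than \<open>i\<close>
  stones.
\<close>

definition steps_from :: "nat \<Rightarrow> nat \<Rightarrow> nat" where
  "steps_from i n = (\<Sum>k<n. of_bool (i \<le> first_empty_pit (board k)))"

text \<open>A step puts \<open>i\<close> stones into pit \<open>i\<close> if that is the first empty
  pit, and removes one if the first empty pit lies further out. The additive form avoids truncated
  subtraction.\<close>

lemma board_steps_from:
  assumes "1 \<le> i"
  shows "board n i + Suc i * steps_from (Suc i) n = i * steps_from i n"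
proof (induction n)
  case 0
  show ?case by (simp add: steps_from_def)
next
  case (Suc n)
  consider "first_empty_pit (board n) < i" | "first_empty_pit (board n) = i"
    | "i < first_empty_pit (board n)" by linarith
  then show ?case
  proof cases
    case 1
    with Suc show ?thesis by (simp add: steps_from_def)
  next
    case 2
    then have "board n i = 0" using first_empty_pit_board(2)[of n] by simp
    with Suc 2 show ?thesis by (simp add: steps_from_def)
  next
    case 3
    with assms have "1 \<le> board n i" by (rule board_below_first_empty_pit)
    with Suc 3 show ?thesis by (simp add: steps_from_def)
  qed
qed

lemma steps_from_1: "steps_from 1 n = n"
  using first_empty_pit_board(1) by (simp add: steps_from_def)

lemma mult_steps_from_le:
  assumes "1 \<le> i"
  shows "i * steps_from i n \<le> n"
  using assms
proof (induction i rule: dec_induct)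
  case base
  show ?case by (simp only: steps_from_1 mult_1 order_refl)
next
  case (step i)
  then show ?case using board_steps_from[of i n] by linarith
qed

lemma steps_from_less:
  assumes "1 \<le> i" "0 < steps_from (Suc i) n"
  shows "steps_from (Suc i) n < steps_from i n"
proof -
  have "i * steps_from (Suc i) n < Suc i * steps_from (Suc i) n"
    using assms(2) by simp
  also have "\<dots> \<le> i * steps_from i n"
    using board_steps_from[OF assms(1), of n] by linarith
  finally show ?thesis by simp
qed

lemma steps_from_ge:
  assumes "i \<le> l" "1 \<le> i" "0 < steps_from l n"
  shows "Suc l - i \<le> steps_from i n"
  using assms
proof (induction i rule: inc_induct)
  case base
  then show ?case by simp
next
  case (step i)
  then have "Suc l - Suc i \<le> steps_from (Suc i) n" by simp
  with step.hyps step.prems steps_from_less[of i n] show ?case by linarith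
qed

lemma board_at_length:
  assumes "0 < board_length n"
  shows "0 < board n (board_length n)"
proof (rule ccontr)
  assume "\<not> ?thesis"
  then have "board n j = 0" if "j > board_length n - 1" for j
    using that board_beyond_length[of n j] by (cases "j = board_length n") auto
  then have "board_length n \<le> board_length n - 1" by (rule board_length_le)
  with assms show False by simp
qed

text \<open>A step can empty the last nonempty pit only if the first empty pit lies beyond it; but
  that pit is then filled, so the board cannot get shorter.\<close>

lemma mono_board_length: "mono board_length"
proof (rule mono_iff_le_Suc[THEN iffD2, rule_format], rule ccontr)
  fix n
  assume "\<not> board_length n \<le> board_length (Suc n)"
  then have less: "board_length (Suc n) < board_length n" by simp
  define l p where "l = board_length n" and "p = first_empty_pit (board n)"
  have l: "0 < board n l" "board (Suc n) l = 0"
    using less board_at_length[of n] board_beyond_length[OF less] by (auto simp: l_def)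
  have p: "1 \<le> p" "board n p = 0"
    using first_empty_pit_board[of n] by (auto simp: p_def)
  have "l < p"
    using l p by (cases l p rule: linorder_cases) (auto simp: p_def)
  then have "board (Suc n) p = 0"
    using less by (intro board_beyond_length) (simp add: l_def)
  with p show False by (simp add: p_def)
qed

lemma board_length_min_stones: "board_length (min_stones l) = l"
  unfolding min_stones_def by (rule LeastI_ex[OF board_length_surj])

lemma min_stones_le: "2 * min_stones l \<le> l * (l + 1)"
proof -
  \<comment> \<open>Monotonicity keeps all earlier boards within the pits up to \<open>l\<close>, as
    \<open>board_stones\<close> requires.\<close>
  have "\<forall>k\<le>min_stones l. board_length k \<le> l"
    using monoD[OF mono_board_length, of _ "min_stones l"] by (simp add: board_length_min_stones)
  then have "min_stones l = (\<Sum>i=1..l. board (min_stones l) i)"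
    by (rule board_stones[symmetric])
  also have "\<dots> \<le> (\<Sum>i=1..l. i)"
    by (intro sum_mono board_le)
  also have "2 * \<dots> = l * (l + 1)"
    by (induction l) auto
  finally show ?thesis by simp
qed

lemma square_board_length_le: "board_length n ^ 2 \<le> 4 * n"
proof (cases "board_length n = 0")
  case False
  define l where "l = board_length n"
  define i where "i = (l + 1) div 2"
  have "1 \<le> l" using False by (simp add: l_def)
  have "0 < board n l" using False board_at_length by (simp add: l_def)
  then have "0 < l * steps_from l n"
    using board_steps_from[OF \<open>1 \<le> l\<close>, of n] by linarith
  then have "i * (Suc l - i) \<le> i * steps_from i n"
    using \<open>1 \<le> l\<close> by (intro mult_le_mono2 steps_from_ge) (auto simp: i_def)
  also have "\<dots> \<le> n"
    using \<open>1 \<le> l\<close> by (intro mult_steps_from_le) (simp add: i_def)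
  finally have le: "i * (Suc l - i) \<le> n" .
  \<comment> \<open>In either parity both \<open>i\<close> and \<open>Suc l - i\<close> are at least
    \<open>l / 2\<close>, so rounding costs nothing.\<close>
  have "l = 2 * i \<or> Suc l = 2 * i" unfolding i_def by presburger
  then have "l \<le> 2 * i" "l \<le> 2 * (Suc l - i)" by auto
  then have "l * l \<le> (2 * i) * (2 * (Suc l - i))" by (rule mult_le_mono)
  also have "\<dots> \<le> 4 * n" using le by simp
  finally show ?thesis by (simp add: l_def power2_eq_square)
qed simp

theorem theorem3p6:
  shows "(\<lambda>l. real (min_stones l)) \<in> O(\<lambda>l. real l ^ 2) \<and>
    (\<exists>C::real. \<forall>l::nat. l \<ge> 1 \<longrightarrow>
       real l ^ 2 / 4 - C * real l \<le> real (min_stones l) \<and>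
       real (min_stones l) \<le> real l ^ 2 / 2 + C * real l)"
proof
  have upper: "real (min_stones l) \<le> real l ^ 2 / 2 + 1/2 * real l" for l
  proof -
    have "real (2 * min_stones l) \<le> real (l * (l + 1))"
      using min_stones_le by (rule of_nat_mono)
    then show ?thesis by (simp add: power2_eq_square field_simps)
  qed
  have lower: "real l ^ 2 / 4 \<le> real (min_stones l)" for l
  proof -
    have "real (l ^ 2) \<le> real (4 * min_stones l)"
      using square_board_length_le[of "min_stones l"]
      unfolding board_length_min_stones by (rule of_nat_mono)
    then show ?thesis by simp
  qed
  show "(\<lambda>l. real (min_stones l)) \<in> O(\<lambda>l. real l ^ 2)"
  proof (rule bigoI[of _ 1], rule always_eventually, rule allI)
    fix l :: nat
    have "real l \<le> real l ^ 2"
      by (cases l) (simp_all add: power2_eq_square)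
    with upper[of l] have "real (min_stones l) \<le> real l ^ 2" by linarith
    then show "norm (real (min_stones l)) \<le> 1 * norm (real l ^ 2)"
      by (simp only: real_norm_def abs_of_nat abs_power2 power_abs mult_1)
  qed
  show "\<exists>C::real. \<forall>l::nat. l \<ge> 1 \<longrightarrow>
       real l ^ 2 / 4 - C * real l \<le> real (min_stones l) \<and>
       real (min_stones l) \<le> real l ^ 2 / 2 + C * real l"
  \<comment> \<open>The constant is the linear coefficient of \<open>l * (l + 1) / 2\<close>; the
    lower bound has no linear error.\<close>
  proof (intro exI[of _ "1/2"] allI impI conjI)
    fix l :: nat
    show "real l ^ 2 / 4 - 1/2 * real l \<le> real (min_stones l)"
      using lower[of l] by simp
    show "real (min_stones l) \<le> real l ^ 2 / 2 + 1/2 * real l"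
      by (rule upper)
  qed
qed

end
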